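(* Let $(G,\mu)$ be a countable measured group and suppose $(X,\nu)$ is a compact minimal $(G,\mu)$-space such that $\sigma_\nu(s,\cdot)$ is continuous for every $s\in G$. If $\nu$ is not $G$-invariant, then for every $\varepsilon>0$ there exists an integer $n$ such that $$\sup_{x\in X}\int_G\sigma_\nu(s,x)^{1-2\varepsilon}\,d\mu^{*n}(s)<1.$$
   Context: A measured group $(G,\mu)$ is a countable group $G$ with a probability measure $\mu$ whose support generates $G$ as a semigroup; $\mu^{*n}$ is the $n$-th convolution power of $\mu$. A compact $(G,\mu)$-space $(X,\nu)$ is a compact metrizable space $X$ with an action of $G$ by homeomorphisms and a Borel probability measure $\nu$, whose measure class is preserved by $G$, such that $\int_G\int_X\phi(s^{-1}x)\,d\nu(x)\,d\mu(s)=\int_X\phi\,d\nu$ for all $\phi\in C(X)$. It is minimal if every $G$-orbit is dense in $X$. $\sigma_\nu(s,x)=\frac{ds^{-1}\nu}{d\nu}(x)$ is the Radon–Nikodym derivative, where $s^{-1}\nu$ is the push-forward of $\nu$ under $x\mapsto s^{-1}x$. The hypothesis that $\sigma_\nu(s,\cdot)$ is continuous means that it has a continuous representative, and $\sigma_\nu(s,\cdot)$ denotes this representative.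
   Formalization: The claim is proved for 0 < ε < 1/2 only; for ε = 1/2 the integral is identically 1, and for ε > 1/2 Jensen's inequality makes it at least 1 at every x, so the printed claim "for every ε > 0" fails there. *)

theory Defs
  imports "HOL-Probability.Probability" "HOL-Algebra.Group_Action"
begin

inductive_set semigroup_generated :: "('g, 'b) monoid_scheme \<Rightarrow> 'g set \<Rightarrow> 'g set"
  for G (structure) and S where
  base: "s \<in> S \<Longrightarrow> s \<in> semigroup_generated G S"
| mult: "s \<in> semigroup_generated G S \<Longrightarrow> t \<in> semigroup_generated G S
    \<Longrightarrow> s \<otimes> t \<in> semigroup_generated G S"

locale measured_group = group G for G :: "('g, 'b) monoid_scheme" (structure) +
  fixes \<mu> :: "'g pmf"
  assumes countable_carrier: "countable (carrier G)"
    and support_subset: "set_pmf \<mu> \<subseteq> carrier G"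
    and support_generates: "semigroup_generated G (set_pmf \<mu>) = carrier G"

definition convolution :: "('g, 'b) monoid_scheme \<Rightarrow> 'g pmf \<Rightarrow> 'g pmf \<Rightarrow> 'g pmf" where
  "convolution G \<mu> \<eta> = map_pmf (\<lambda>(s, t). s \<otimes>\<^bsub>G\<^esub> t) (pair_pmf \<mu> \<eta>)"

primrec convolution_power :: "('g, 'b) monoid_scheme \<Rightarrow> 'g pmf \<Rightarrow> nat \<Rightarrow> 'g pmf" where
  "convolution_power G \<mu> 0 = return_pmf \<one>\<^bsub>G\<^esub>"
| "convolution_power G \<mu> (Suc n) = convolution G \<mu> (convolution_power G \<mu> n)"

definition translate ::
  "('g \<Rightarrow> 'x \<Rightarrow> 'x) \<Rightarrow> 'x::topological_space measure \<Rightarrow> 'g \<Rightarrow> 'x measure" where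
  "translate act \<nu> s = distr \<nu> borel (act s)"

locale compact_stationary_space =
  measured_group G \<mu> + group_action G "UNIV :: 'x set" act
  for G :: "('g, 'b) monoid_scheme" (structure) and \<mu> :: "'g pmf"
    and act :: "'g \<Rightarrow> 'x::topological_space \<Rightarrow> 'x" +
  fixes \<nu> :: "'x measure"
  assumes compact: "compact (UNIV :: 'x set)"
    and metrizable: "metrizable_space (euclidean :: 'x topology)"
    and homeomorphic: "s \<in> carrier G \<Longrightarrow> homeomorphic_map euclidean euclidean (act s)"
    and borel: "sets \<nu> = sets borel"
    and prob: "prob_space \<nu>"
    and measure_class_preserved: "s \<in> carrier G \<Longrightarrow>
      absolutely_continuous \<nu> (translate act \<nu> s) \<and> absolutely_continuous (translate act \<nu> s) \<nu>"
    and stationary: "continuous_on UNIV (\<phi> :: 'x \<Rightarrow> real) \<Longrightarrow>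
      (\<integral>s. (\<integral>x. \<phi> (act (inv s) x) \<partial>\<nu>) \<partial>measure_pmf \<mu>) = (\<integral>x. \<phi> x \<partial>\<nu>)"

definition minimal_action ::
  "('g, 'b) monoid_scheme \<Rightarrow> ('g \<Rightarrow> 'x::topological_space \<Rightarrow> 'x) \<Rightarrow> bool" where
  "minimal_action G act \<longleftrightarrow> (\<forall>x. closure (orbit G act x) = UNIV)"

definition invariant_measure :: "('g, 'b) monoid_scheme \<Rightarrow> ('g \<Rightarrow> 'x \<Rightarrow> 'x)
    \<Rightarrow> 'x::topological_space measure \<Rightarrow> bool" where
  "invariant_measure G act \<nu> \<longleftrightarrow> (\<forall>s\<in>carrier G. translate act \<nu> s = \<nu>)"

text \<open>
  \<open>RN_deriv\<close> is an arbitrary version of the derivative, determined only up to a null set, so the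
  cocycle is always used through a continuous representative. For a minimal action \<open>\<nu>\<close> has full
  support, hence that representative is unique.
\<close>

definition RN_cocycle :: "('g, 'b) monoid_scheme \<Rightarrow> ('g \<Rightarrow> 'x \<Rightarrow> 'x)
    \<Rightarrow> 'x::topological_space measure \<Rightarrow> 'g \<Rightarrow> 'x \<Rightarrow> real" where
  "RN_cocycle G act \<nu> s x = enn2real (RN_deriv \<nu> (translate act \<nu> (inv\<^bsub>G\<^esub> s)) x)"

definition continuous_representative ::
  "'x::topological_space measure \<Rightarrow> ('x \<Rightarrow> real) \<Rightarrow> ('x \<Rightarrow> real) \<Rightarrow> bool" where
  "continuous_representative \<nu> f h \<longleftrightarrow> continuous_on UNIV h \<and> (AE x in \<nu>. h x = f x)"

end

theory Submission
  imports Defs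
begin

text \<open>
  Put \<open>p = 1 - 2\<epsilon> \<in> (0,1)\<close> and \<open>f\<^sub>n(x) = \<integral> \<sigma>(s,x)\<^sup>p d\<mu>\<^sup>*\<^sup>n(s)\<close>. Stationarity gives
  \<open>\<integral> \<sigma>(s,x) d\<mu>\<^sup>*\<^sup>n(s) \<le> 1\<close> for \<^emph>\<open>every\<close> \<open>x\<close>, because \<open>\<nu>\<close> has full support. The quantitative
  concavity estimate \<open>u\<^sup>p \<le> 1 - p + pu - p(1 - p)(\<surd>u - 1)\<^sup>2\<close> then yields
  \<open>f\<^sub>n(x) \<le> 1 - p(1 - p) \<mu>\<^sup>*\<^sup>n(s) (\<surd>\<sigma>(s,x) - 1)\<^sup>2\<close> for each single \<open>s\<close>, and the right-hand side is
  continuous in \<open>x\<close>. If \<open>\<sigma>(s,x) = 1\<close> held for all \<open>s\<close> at some point \<open>x\<close>, the cocycle identity would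
  propagate this along the dense orbit of \<open>x\<close> and \<open>\<nu>\<close> would be invariant; hence every point has a
  neighbourhood on which some \<open>f\<^sub>n\<close> is bounded away from \<open>1\<close>. By the cocycle identity \<open>f\<^sub>n\<close>
  decreases in \<open>n\<close>, so compactness provides one \<open>n\<close> for all points.
\<close>

lemma powr_le_tangent_minus_square:
  fixes u p :: real
  assumes "0 \<le> u" and p: "0 \<le> p" "p \<le> 1"
  shows "u powr p \<le> 1 - p + p * u - p * (1 - p) * (sqrt u - 1)\<^sup>2"
proof (cases "u = 0")
  case True
  have "1 - p - p * (1 - p) = (1 - p)\<^sup>2" by (simp add: power2_eq_square algebra_simps)
  with True show ?thesis by simp
next
  case False
  define v where "v = sqrt u"
  have v: "0 < v" "u = v\<^sup>2" using False \<open>0 \<le> u\<close> by (auto simp: v_def)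
  have "u powr p = (v powr p)\<^sup>2"
    using v by (simp add: power2_eq_square powr_mult)
  also have "\<dots> \<le> (1 - p + p * v)\<^sup>2"
    using Youngs_inequality_0[of p "1 - p" v 1] p v by (intro power_mono) auto
  also have "\<dots> = 1 - p + p * v\<^sup>2 - p * (1 - p) * (v - 1)\<^sup>2"
    by (simp add: power2_eq_square algebra_simps)
  finally show ?thesis using v by simp
qed

lemma compact_decseq_SUP_less:
  fixes f :: "nat \<Rightarrow> 'a::topological_space \<Rightarrow> 'b::complete_linorder"
  assumes K: "compact K" and dec: "\<And>x. x \<in> K \<Longrightarrow> decseq (\<lambda>n. f n x)" and "bot < b"
    and locally_less: "\<And>x. x \<in> K \<Longrightarrow> \<exists>n c. c < b \<and> (\<forall>\<^sub>F y in nhds x. f n y \<le> c)"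
  shows "\<exists>n. (SUP x\<in>K. f n x) < b"
proof -
  have "\<exists>n c U. c < b \<and> open U \<and> x \<in> U \<and> (\<forall>y\<in>U. f n y \<le> c)" if "x \<in> K" for x
    using locally_less[OF that] unfolding eventually_nhds by blast
  then obtain n c U where c: "\<And>x. x \<in> K \<Longrightarrow> c x < b"
    and U: "\<And>x. x \<in> K \<Longrightarrow> open (U x)" "\<And>x. x \<in> K \<Longrightarrow> x \<in> U x"
    and le: "\<And>x y. x \<in> K \<Longrightarrow> y \<in> U x \<Longrightarrow> f (n x) y \<le> c x"
    by metis
  obtain D where D: "D \<subseteq> K" "finite D" "K \<subseteq> (\<Union>x\<in>D. U x)"
    using compactE_image[OF K, of K U] U by blast
  define N where "N = Max (insert 0 (n ` D))"
  have "(SUP x\<in>K. f N x) \<le> Max (insert bot (c ` D))"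
  proof (rule SUP_least)
    fix y assume y: "y \<in> K"
    then obtain x where x: "x \<in> D" "y \<in> U x" using D by blast
    have "f N y \<le> f (n x) y"
      using D x by (intro decseqD[OF dec[OF y]]) (simp add: N_def)
    also have "\<dots> \<le> c x" using D x le by blast
    also have "\<dots> \<le> Max (insert bot (c ` D))" using D x by simp
    finally show "f N y \<le> Max (insert bot (c ` D))" .
  qed
  also have "\<dots> < b" using D c \<open>bot < b\<close> by auto
  finally show ?thesis ..
qed

text \<open>For \<open>h = (g - c)\<^sup>+\<close> one has \<open>g h = c h + h\<^sup>2\<close>, so the hypothesis forces \<open>\<integral> h\<^sup>2 \<le> 0\<close>.\<close>

lemma AE_le_const_if_nn_integral_le:
  fixes g :: "'a \<Rightarrow> real"
  assumes [measurable]: "g \<in> borel_measurable M" and "0 \<le> c"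
    and finite: "(\<integral>\<^sup>+ x. ennreal (max 0 (g x - c)) \<partial>M) < \<infinity>"
    and le: "(\<integral>\<^sup>+ x. ennreal (g x * max 0 (g x - c)) \<partial>M)
      \<le> (\<integral>\<^sup>+ x. ennreal (c * max 0 (g x - c)) \<partial>M)"
  shows "AE x in M. g x \<le> c"
proof -
  define h where "h x = max 0 (g x - c)" for x
  have [measurable]: "h \<in> borel_measurable M" unfolding h_def by measurable
  have split: "ennreal (g x * h x) = ennreal (c * h x) + ennreal ((h x)\<^sup>2)" for x
  proof -
    have "g x * h x = c * h x + (h x)\<^sup>2"
      by (auto simp: h_def max_def power2_eq_square algebra_simps)
    moreover have "0 \<le> c * h x" using \<open>0 \<le> c\<close> by (simp add: h_def)
    ultimately show ?thesis by (simp flip: ennreal_plus)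
  qed
  have "(\<integral>\<^sup>+ x. ennreal (c * h x) \<partial>M) + (\<integral>\<^sup>+ x. ennreal ((h x)\<^sup>2) \<partial>M)
      \<le> (\<integral>\<^sup>+ x. ennreal (c * h x) \<partial>M) + 0"
    using le by (simp add: split nn_integral_add flip: h_def)
  moreover have "(\<integral>\<^sup>+ x. ennreal (c * h x) \<partial>M) < \<infinity>"
    using finite \<open>0 \<le> c\<close>
    by (simp add: ennreal_mult' nn_integral_cmult ennreal_mult_less_top flip: h_def)
  ultimately have "(\<integral>\<^sup>+ x. ennreal ((h x)\<^sup>2) \<partial>M) = 0"
    unfolding ennreal_add_left_cancel_le by auto
  then have "AE x in M. ennreal ((h x)\<^sup>2) = 0"
    by (subst (asm) nn_integral_0_iff_AE) auto
  then show ?thesis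
    by eventually_elim (auto simp: h_def max_def split: if_splits)
qed

lemma nn_integral_measure_pmf_SUP_finite:
  fixes f :: "'a \<Rightarrow> ennreal"
  shows "(\<integral>\<^sup>+ s. f s \<partial>measure_pmf \<eta>) =
    (SUP F\<in>{F. finite F \<and> F \<subseteq> set_pmf \<eta>}. \<Sum>s\<in>F. f s * pmf \<eta> s)"
proof (rule antisym)
  have restrict: "(\<integral>\<^sup>+ s. f s * indicator F s \<partial>measure_pmf \<eta>) = (\<Sum>s\<in>F. f s * pmf \<eta> s)"
    if "finite F" for F
    using that by (subst nn_integral_measure_pmf_support[of F]) auto
  show "(SUP F\<in>{F. finite F \<and> F \<subseteq> set_pmf \<eta>}. \<Sum>s\<in>F. f s * pmf \<eta> s) \<le> (\<integral>\<^sup>+ s. f s \<partial>measure_pmf \<eta>)"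
    by (rule SUP_least) (auto simp: indicator_def simp flip: restrict intro!: nn_integral_mono)
  define E where "E k = {s \<in> set_pmf \<eta>. to_nat_on (set_pmf \<eta>) s < k}" for k
  have finite_E: "finite (E k)" for k
    by (rule finite_imageD[of "to_nat_on (set_pmf \<eta>)"])
      (auto simp: E_def intro!: finite_subset[of _ "{..<k}"]
        inj_on_subset[OF inj_on_to_nat_on[OF countable_set_pmf]])
  have "(\<integral>\<^sup>+ s. f s \<partial>measure_pmf \<eta>) = (\<integral>\<^sup>+ s. (SUP k. f s * indicator (E k) s) \<partial>measure_pmf \<eta>)"
  proof (intro nn_integral_cong_AE AE_pmfI)
    fix s assume "s \<in> set_pmf \<eta>"
    then have "s \<in> E (Suc (to_nat_on (set_pmf \<eta>) s))" by (simp add: E_def)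
    then show "f s = (SUP k. f s * indicator (E k) s)"
      by (intro antisym SUP_upper2[OF UNIV_I] SUP_least) (auto simp: indicator_def)
  qed
  also have "\<dots> = (SUP k. \<integral>\<^sup>+ s. f s * indicator (E k) s \<partial>measure_pmf \<eta>)"
    by (intro nn_integral_monotone_convergence_SUP)
      (auto simp: incseq_def le_fun_def indicator_def E_def)
  also have "\<dots> = (SUP k. \<Sum>s\<in>E k. f s * pmf \<eta> s)"
    using finite_E by (simp add: restrict)
  also have "\<dots> \<le> (SUP F\<in>{F. finite F \<and> F \<subseteq> set_pmf \<eta>}. \<Sum>s\<in>F. f s * pmf \<eta> s)"
    using finite_E by (intro SUP_least SUP_upper) (auto simp: E_def)
  finally show "(\<integral>\<^sup>+ s. f s \<partial>measure_pmf \<eta>)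
      \<le> (SUP F\<in>{F. finite F \<and> F \<subseteq> set_pmf \<eta>}. \<Sum>s\<in>F. f s * pmf \<eta> s)" .
qed

lemma sum_pmf_le_nn_integral:
  fixes f :: "'a \<Rightarrow> ennreal"
  assumes "finite F"
  shows "(\<Sum>s\<in>F. f s * pmf \<eta> s) \<le> (\<integral>\<^sup>+ s. f s \<partial>measure_pmf \<eta>)"
proof -
  have "(\<Sum>s\<in>F. f s * pmf \<eta> s) = (\<Sum>s\<in>F \<inter> set_pmf \<eta>. f s * pmf \<eta> s)"
    using assms by (intro sum.mono_neutral_right) (auto simp: set_pmf_iff)
  then show ?thesis
    unfolding nn_integral_measure_pmf_SUP_finite using assms by (auto intro: SUP_upper)
qed

lemma nn_integral_convolution:
  "(\<integral>\<^sup>+ s. f s \<partial>measure_pmf (convolution G \<mu> \<eta>)) =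
    (\<integral>\<^sup>+ t. (\<integral>\<^sup>+ s. f (s \<otimes>\<^bsub>G\<^esub> t) \<partial>measure_pmf \<mu>) \<partial>measure_pmf \<eta>)"
  unfolding convolution_def
  by (subst pair_commute_pmf) (simp add: nn_integral_pair_pmf')

lemma set_pmf_convolution:
  "set_pmf (convolution G \<mu> \<eta>) = {s \<otimes>\<^bsub>G\<^esub> t | s t. s \<in> set_pmf \<mu> \<and> t \<in> set_pmf \<eta>}"
  by (auto simp: convolution_def)

context measured_group
begin

lemma set_pmf_convolution_power_subset: "set_pmf (convolution_power G \<mu> n) \<subseteq> carrier G"
  using support_subset by (induction n) (auto simp: set_pmf_convolution)

lemma mult_mem_set_pmf_convolution_power:
  assumes "s \<in> set_pmf (convolution_power G \<mu> m)" "t \<in> set_pmf (convolution_power G \<mu> n)"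
  shows "s \<otimes> t \<in> set_pmf (convolution_power G \<mu> (m + n))"
  using assms(1)
proof (induction m arbitrary: s)
  case 0
  then show ?case using assms(2) set_pmf_convolution_power_subset[of n] by auto
next
  case (Suc m)
  then obtain a b where ab: "s = a \<otimes> b" "a \<in> set_pmf \<mu>" "b \<in> set_pmf (convolution_power G \<mu> m)"
    by (auto simp: set_pmf_convolution)
  have "s \<otimes> t = a \<otimes> (b \<otimes> t)"
    using ab assms(2) support_subset set_pmf_convolution_power_subset
    by (auto intro!: m_assoc)
  with ab Suc.IH show ?case by (auto simp: set_pmf_convolution)
qed

lemma carrier_eq_UN_set_pmf_convolution_power:
  "carrier G = (\<Union>n. set_pmf (convolution_power G \<mu> n))"
proof
  show "carrier G \<subseteq> (\<Union>n. set_pmf (convolution_power G \<mu> n))"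
  proof
    fix s assume "s \<in> carrier G"
    then have "s \<in> semigroup_generated G (set_pmf \<mu>)" by (simp add: support_generates)
    then show "s \<in> (\<Union>n. set_pmf (convolution_power G \<mu> n))"
    proof induction
      case (base s)
      have "s \<in> set_pmf (convolution_power G \<mu> 1)"
        using base support_subset by (force simp: set_pmf_convolution)
      then show ?case by blast
    next
      case (mult s t)
      then show ?case using mult_mem_set_pmf_convolution_power by blast
    qed
  qed
qed (use set_pmf_convolution_power_subset in blast)

end

sublocale compact_stationary_space \<subseteq> prob_space \<nu>
  by (rule prob)

context compact_stationary_space
begin

lemma space_eq_UNIV [simp]: "space \<nu> = UNIV"
  using sets_eq_imp_space_eq[OF borel] by simp

lemma measurable_eq_borel: "measurable \<nu> M = measurable borel M"
  by (rule measurable_cong_sets[OF borel refl])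

lemma continuous_act: "s \<in> carrier G \<Longrightarrow> continuous_on UNIV (act s)"
  using homeomorphic_imp_continuous_map[OF homeomorphic] by simp

lemma measurable_act [measurable]: "s \<in> carrier G \<Longrightarrow> act s \<in> borel_measurable borel"
  by (intro borel_measurable_continuous_onI continuous_act)

lemma act_one: "act \<one> x = x"
  using fun_cong[OF id_eq_one, of x] by simp

lemma act_inv_act: "s \<in> carrier G \<Longrightarrow> act (inv s) (act s x) = x"
  by (rule orbit_sym_aux) auto

lemma integrable_continuous:
  fixes \<phi> :: "'x \<Rightarrow> real"
  assumes "continuous_on UNIV \<phi>"
  shows "integrable \<nu> \<phi>"
proof -
  obtain B where "\<And>x. norm (\<phi> x) \<le> B"
    using continuous_on_compact_bound[OF compact assms] by auto
  with assms show ?thesis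
    by (intro integrable_const_bound[where B = B])
      (auto simp: measurable_eq_borel intro: borel_measurable_continuous_onI)
qed

lemma nn_integral_stationary:
  fixes \<phi> :: "'x \<Rightarrow> real"
  assumes cont: "continuous_on UNIV \<phi>" and nonneg: "\<And>x. 0 \<le> \<phi> x"
  shows "(\<integral>\<^sup>+ s. (\<integral>\<^sup>+ x. ennreal (\<phi> (act (inv s) x)) \<partial>\<nu>) \<partial>measure_pmf \<mu>) =
    (\<integral>\<^sup>+ x. ennreal (\<phi> x) \<partial>\<nu>)"
proof -
  define I where "I s = (\<integral>x. \<phi> (act (inv s) x) \<partial>\<nu>)" for s
  have integrable: "integrable \<nu> (\<lambda>x. \<phi> (act (inv s) x))" if "s \<in> carrier G" for s
    using that continuous_on_compose2[OF cont continuous_act[of "inv s"]]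
    by (intro integrable_continuous) auto
  have I_nonneg: "0 \<le> I s" for s
    unfolding I_def using nonneg by (intro integral_nonneg_AE) simp
  obtain B where B: "\<And>x. \<phi> x \<le> B"
    using continuous_on_compact_bound[OF compact cont] by (metis UNIV_I abs_le_D1 real_norm_def)
  have "I s \<le> B" if "s \<in> carrier G" for s
    unfolding I_def using integrable[OF that] B by (intro integral_le_const) auto
  then have "integrable (measure_pmf \<mu>) I"
    using I_nonneg support_subset
    by (intro measure_pmf.integrable_const_bound[where B = B]) (auto simp: AE_measure_pmf_iff)
  then have "(\<integral>\<^sup>+ s. ennreal (I s) \<partial>measure_pmf \<mu>) = ennreal (\<integral>s. I s \<partial>measure_pmf \<mu>)"
    using I_nonneg by (intro nn_integral_eq_integral) auto
  moreover have "(\<integral>\<^sup>+ s. (\<integral>\<^sup>+ x. ennreal (\<phi> (act (inv s) x)) \<partial>\<nu>) \<partial>measure_pmf \<mu>) =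
      (\<integral>\<^sup>+ s. ennreal (I s) \<partial>measure_pmf \<mu>)"
    unfolding I_def using integrable nonneg support_subset
    by (intro nn_integral_cong_AE) (auto simp: AE_measure_pmf_iff nn_integral_eq_integral)
  moreover have "(\<integral>\<^sup>+ x. ennreal (\<phi> x) \<partial>\<nu>) = ennreal (\<integral>x. \<phi> x \<partial>\<nu>)"
    using integrable_continuous[OF cont] nonneg by (intro nn_integral_eq_integral) auto
  ultimately show ?thesis using stationary[OF cont] by (simp add: I_def)
qed

lemma null_sets_vimage_act:
  assumes s: "s \<in> carrier G" and A: "A \<in> null_sets \<nu>"
  shows "act s -` A \<in> null_sets \<nu>"
proof -
  have "A \<in> null_sets (translate act \<nu> s)"
    using measure_class_preserved[OF s] A by (auto simp: absolutely_continuous_def)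
  then show ?thesis
    using s by (simp add: translate_def null_sets_distr_iff measurable_eq_borel)
qed

end

locale minimal_stationary_space = compact_stationary_space G \<mu> act \<nu>
  for G :: "('g, 'b) monoid_scheme" (structure) and \<mu> :: "'g pmf"
    and act :: "'g \<Rightarrow> 'x::topological_space \<Rightarrow> 'x" and \<nu> :: "'x measure" +
  assumes minimal: "minimal_action G act"
begin

lemma UN_vimage_act_open:
  assumes "open U" "U \<noteq> {}"
  shows "(\<Union>s\<in>carrier G. act s -` U) = UNIV"
proof -
  have "U \<inter> orbit G act x \<noteq> {}" for x
    using minimal assms open_Int_closure_eq_empty[of U "orbit G act x"]
    by (auto simp: minimal_action_def)
  then show ?thesis by (fastforce simp: orbit_def)
qed

lemma open_null_set_empty:
  assumes U: "open U" "U \<in> null_sets \<nu>"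
  shows "U = {}"
proof (rule ccontr)
  assume "U \<noteq> {}"
  have "(\<Union>s\<in>carrier G. act s -` U) \<in> null_sets \<nu>"
    by (intro null_sets_UN' countable_carrier null_sets_vimage_act U)
  then have "UNIV \<in> null_sets \<nu>"
    by (simp add: UN_vimage_act_open U \<open>U \<noteq> {}\<close>)
  then show False using emeasure_space_1 by auto
qed

lemma closed_AE_imp_all:
  assumes "closed {x. P x}" "AE x in \<nu>. P x"
  shows "P x"
proof -
  have "open {x. \<not> P x}" using assms(1) by (simp add: closed_def Collect_neg_eq)
  moreover from this have "{x. \<not> P x} \<in> null_sets \<nu>"
    using assms(2) by (subst (asm) AE_iff_null) (auto simp: borel)
  ultimately show ?thesis using open_null_set_empty by blast
qed

lemma continuous_eq_if_density_eq:
  fixes f g :: "'x \<Rightarrow> real"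
  assumes f: "continuous_on UNIV f" "\<And>x. 0 \<le> f x" and g: "continuous_on UNIV g" "\<And>x. 0 \<le> g x"
    and eq: "density \<nu> (\<lambda>x. ennreal (f x)) = density \<nu> (\<lambda>x. ennreal (g x))"
  shows "f x = g x"
proof (rule closed_AE_imp_all[where P = "\<lambda>x. f x = g x"])
  show "closed {x. f x = g x}"
    using f g by (intro closed_Collect_eq)
  have [measurable]: "f \<in> borel_measurable borel" "g \<in> borel_measurable borel"
    using f g by (auto intro: borel_measurable_continuous_onI)
  have "AE x in \<nu>. ennreal (f x) = ennreal (g x)"
    using eq by (subst (asm) density_unique_iff) (auto simp: measurable_eq_borel)
  then show "AE x in \<nu>. f x = g x"
    by eventually_elim (use f g in simp)
qed

end

locale continuous_cocycle_space = minimal_stationary_space G \<mu> act \<nu>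
  for G :: "('g, 'b) monoid_scheme" (structure) and \<mu> :: "'g pmf"
    and act :: "'g \<Rightarrow> 'x::topological_space \<Rightarrow> 'x" and \<nu> :: "'x measure" +
  fixes \<sigma> :: "'g \<Rightarrow> 'x \<Rightarrow> real"
  assumes representative:
    "s \<in> carrier G \<Longrightarrow> continuous_representative \<nu> (RN_cocycle G act \<nu> s) (\<sigma> s)"
begin

lemma continuous_sigma: "s \<in> carrier G \<Longrightarrow> continuous_on UNIV (\<sigma> s)"
  using representative by (auto simp: continuous_representative_def)

lemma measurable_sigma [measurable]: "s \<in> carrier G \<Longrightarrow> \<sigma> s \<in> borel_measurable borel"
  by (intro borel_measurable_continuous_onI continuous_sigma)

lemma sigma_nonneg: "s \<in> carrier G \<Longrightarrow> 0 \<le> \<sigma> s x"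
proof (rule closed_AE_imp_all[where P = "\<lambda>x. 0 \<le> \<sigma> s x"])
  assume s: "s \<in> carrier G"
  show "closed {x. 0 \<le> \<sigma> s x}"
    by (intro closed_Collect_le continuous_intros continuous_sigma s)
  show "AE x in \<nu>. 0 \<le> \<sigma> s x"
    using representative[OF s] by (auto simp: continuous_representative_def RN_cocycle_def)
qed

lemma translate_inv_eq_density:
  assumes s: "s \<in> carrier G"
  shows "translate act \<nu> (inv s) = density \<nu> (\<lambda>x. ennreal (\<sigma> s x))"
proof -
  let ?N = "translate act \<nu> (inv s)"
  interpret N: prob_space ?N
    unfolding translate_def using s by (intro prob_space_distr) (simp add: measurable_eq_borel)
  have ac: "absolutely_continuous \<nu> ?N" and sets: "sets ?N = sets \<nu>"
    using measure_class_preserved[of "inv s"] s by (auto simp: translate_def borel)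
  have "AE x in \<nu>. RN_deriv \<nu> ?N x \<noteq> \<infinity>"
    by (rule RN_deriv_finite[OF _ ac sets]) unfold_locales
  moreover have "AE x in \<nu>. \<sigma> s x = enn2real (RN_deriv \<nu> ?N x)"
    using representative[OF s] by (simp add: continuous_representative_def RN_cocycle_def)
  ultimately have "AE x in \<nu>. RN_deriv \<nu> ?N x = ennreal (\<sigma> s x)"
    by eventually_elim (simp add: less_top)
  then have "density \<nu> (RN_deriv \<nu> ?N) = density \<nu> (\<lambda>x. ennreal (\<sigma> s x))"
    using s by (intro density_cong borel_measurable_RN_deriv) (auto simp: measurable_eq_borel)
  then show ?thesis
    using density_RN_deriv[OF ac sets] by simp
qed

lemma nn_integral_act_inv:
  assumes s: "s \<in> carrier G" and [measurable]: "f \<in> borel_measurable borel"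
  shows "(\<integral>\<^sup>+ x. f (act (inv s) x) \<partial>\<nu>) = (\<integral>\<^sup>+ x. ennreal (\<sigma> s x) * f x \<partial>\<nu>)"
proof -
  have "(\<integral>\<^sup>+ x. f (act (inv s) x) \<partial>\<nu>) = (\<integral>\<^sup>+ x. f x \<partial>translate act \<nu> (inv s))"
    unfolding translate_def using s by (subst nn_integral_distr) (auto simp: measurable_eq_borel)
  also have "\<dots> = (\<integral>\<^sup>+ x. ennreal (\<sigma> s x) * f x \<partial>\<nu>)"
    unfolding translate_inv_eq_density[OF s] using s
    by (subst nn_integral_density) (auto simp: measurable_eq_borel)
  finally show ?thesis .
qed

lemma sigma_one: "\<sigma> \<one> x = 1"
proof (rule continuous_eq_if_density_eq)
  have "translate act \<nu> \<one> = distr \<nu> \<nu> (\<lambda>x. x)"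
    unfolding translate_def by (intro distr_cong) (auto simp: borel act_one)
  then show "density \<nu> (\<lambda>x. ennreal (\<sigma> \<one> x)) = density \<nu> (\<lambda>x. ennreal 1)"
    using translate_inv_eq_density[OF one_closed] by (simp add: distr_id density_1)
qed (auto intro!: continuous_sigma sigma_nonneg)

lemma translate_density:
  assumes t: "t \<in> carrier G" and [measurable]: "f \<in> borel_measurable borel"
  shows "translate act (density \<nu> f) (inv t) = density \<nu> (\<lambda>x. ennreal (\<sigma> t x) * f (act t x))"
proof -
  note [measurable] = measurable_act[OF t] measurable_act[OF inv_closed[OF t]]
    measurable_sigma[OF t]
  have "translate act (density \<nu> f) (inv t) =
      distr (density \<nu> (\<lambda>x. f (act t (act (inv t) x)))) borel (act (inv t))"
    using act_inv_act[OF inv_closed[OF t]] t by (simp add: translate_def)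
  also have "\<dots> = density (translate act \<nu> (inv t)) (\<lambda>x. f (act t x))"
    unfolding translate_def by (rule density_distr[symmetric]) (auto simp: measurable_eq_borel)
  also have "\<dots> = density \<nu> (\<lambda>x. ennreal (\<sigma> t x) * f (act t x))"
    unfolding translate_inv_eq_density[OF t]
    by (rule density_density_eq) (auto simp: measurable_eq_borel)
  finally show ?thesis .
qed

lemma sigma_cocycle:
  assumes s: "s \<in> carrier G" and t: "t \<in> carrier G"
  shows "\<sigma> (s \<otimes> t) x = \<sigma> s (act t x) * \<sigma> t x"
proof (rule continuous_eq_if_density_eq)
  show "continuous_on UNIV (\<lambda>x. \<sigma> s (act t x) * \<sigma> t x)"
    using continuous_on_compose2[OF continuous_sigma[OF s] continuous_act[OF t]]
    by (intro continuous_intros continuous_sigma t) auto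
  have "density \<nu> (\<lambda>x. ennreal (\<sigma> (s \<otimes> t) x)) = translate act \<nu> (inv (s \<otimes> t))"
    using s t by (simp add: translate_inv_eq_density)
  also have "\<dots> = distr \<nu> borel (act (inv t) \<circ> act (inv s))"
    using s t by (simp add: translate_def inv_mult_group composition_rule comp_def cong: distr_cong)
  also have "\<dots> = translate act (translate act \<nu> (inv s)) (inv t)"
    using s t by (simp add: translate_def distr_distr measurable_eq_borel)
  also have "\<dots> = density \<nu> (\<lambda>x. ennreal (\<sigma> t x) * ennreal (\<sigma> s (act t x)))"
    using s t by (simp add: translate_inv_eq_density translate_density)
  also have "\<dots> = density \<nu> (\<lambda>x. ennreal (\<sigma> s (act t x) * \<sigma> t x))"
    using s t by (simp add: ennreal_mult sigma_nonneg mult.commute)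
  finally show "density \<nu> (\<lambda>x. ennreal (\<sigma> (s \<otimes> t) x)) =
      density \<nu> (\<lambda>x. ennreal (\<sigma> s (act t x) * \<sigma> t x))" .
qed (use s t in \<open>auto intro!: continuous_sigma sigma_nonneg mult_nonneg_nonneg\<close>)

lemma invariant_if_sigma_eq_1:
  assumes x: "\<And>s. s \<in> carrier G \<Longrightarrow> \<sigma> s x = 1"
  shows "invariant_measure G act \<nu>"
  unfolding invariant_measure_def
proof
  fix s assume s: "s \<in> carrier G"
  have "closed {y. \<sigma> (inv s) y = 1}"
    using s by (intro closed_Collect_eq continuous_sigma continuous_intros) auto
  moreover have "orbit G act x \<subseteq> {y. \<sigma> (inv s) y = 1}"
    using sigma_cocycle[of "inv s" _ x] x s by (auto simp: orbit_def)
  ultimately have "closure (orbit G act x) \<subseteq> {y. \<sigma> (inv s) y = 1}"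
    by (rule closure_minimal[rotated])
  then have "\<sigma> (inv s) y = 1" for y
    using minimal by (auto simp: minimal_action_def)
  then show "translate act \<nu> s = \<nu>"
    using translate_inv_eq_density[of "inv s"] s by (simp add: density_1)
qed

lemma nn_integral_sum_sigma_le:
  fixes \<phi> :: "'x \<Rightarrow> real"
  assumes F: "finite F" "F \<subseteq> carrier G" and cont: "continuous_on UNIV \<phi>" and nonneg: "\<And>x. 0 \<le> \<phi> x"
  shows "(\<integral>\<^sup>+ x. ennreal ((\<Sum>s\<in>F. \<sigma> s x * pmf \<mu> s) * \<phi> x) \<partial>\<nu>) \<le> (\<integral>\<^sup>+ x. ennreal (\<phi> x) \<partial>\<nu>)"
proof -
  have [measurable]: "\<phi> \<in> borel_measurable borel"
    using cont by (rule borel_measurable_continuous_onI)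
  have "(\<integral>\<^sup>+ x. ennreal ((\<Sum>s\<in>F. \<sigma> s x * pmf \<mu> s) * \<phi> x) \<partial>\<nu>) =
      (\<integral>\<^sup>+ x. (\<Sum>s\<in>F. ennreal (\<sigma> s x) * ennreal (\<phi> x) * pmf \<mu> s) \<partial>\<nu>)"
  proof (rule nn_integral_cong)
    fix x
    have "(\<Sum>s\<in>F. ennreal (\<sigma> s x) * ennreal (\<phi> x) * pmf \<mu> s) =
        (\<Sum>s\<in>F. ennreal (\<sigma> s x * pmf \<mu> s * \<phi> x))"
      using F nonneg by (intro sum.cong) (auto simp: sigma_nonneg subset_iff ennreal_mult mult_ac)
    also have "\<dots> = ennreal ((\<Sum>s\<in>F. \<sigma> s x * pmf \<mu> s) * \<phi> x)"
      using F nonneg by (simp add: sum_distrib_right sum_ennreal sigma_nonneg subset_iff)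
    finally show "ennreal ((\<Sum>s\<in>F. \<sigma> s x * pmf \<mu> s) * \<phi> x) =
        (\<Sum>s\<in>F. ennreal (\<sigma> s x) * ennreal (\<phi> x) * pmf \<mu> s)" by (rule sym)
  qed
  also have "\<dots> = (\<Sum>s\<in>F. (\<integral>\<^sup>+ x. ennreal (\<sigma> s x) * ennreal (\<phi> x) \<partial>\<nu>) * pmf \<mu> s)"
    using F by (simp add: nn_integral_sum nn_integral_multc measurable_eq_borel subset_iff)
  also have "\<dots> = (\<Sum>s\<in>F. (\<integral>\<^sup>+ x. ennreal (\<phi> (act (inv s) x)) \<partial>\<nu>) * pmf \<mu> s)"
    using F by (intro sum.cong) (auto simp: nn_integral_act_inv[of _ "\<lambda>x. ennreal (\<phi> x)"])
  also have "\<dots> \<le> (\<integral>\<^sup>+ s. (\<integral>\<^sup>+ x. ennreal (\<phi> (act (inv s) x)) \<partial>\<nu>) \<partial>measure_pmf \<mu>)"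
    using F(1) by (rule sum_pmf_le_nn_integral)
  also have "\<dots> = (\<integral>\<^sup>+ x. ennreal (\<phi> x) \<partial>\<nu>)"
    using cont nonneg by (rule nn_integral_stationary)
  finally show ?thesis .
qed

text \<open>
  The sum \<open>g\<close> over a \<^emph>\<open>finite\<close> set is continuous, so \<open>(g - 1)\<^sup>+\<close> is an admissible test function for
  stationarity.
\<close>

lemma sum_sigma_le_1:
  assumes F: "finite F" "F \<subseteq> carrier G"
  shows "(\<Sum>s\<in>F. \<sigma> s x * pmf \<mu> s) \<le> 1"
proof -
  define g where "g x = (\<Sum>s\<in>F. \<sigma> s x * pmf \<mu> s)" for x
  have cont: "continuous_on UNIV g"
    unfolding g_def using F by (intro continuous_intros continuous_sigma) auto
  then have cont_pos: "continuous_on UNIV (\<lambda>x. max 0 (g x - 1))"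
    by (intro continuous_intros)
  have "AE x in \<nu>. g x \<le> 1"
  proof (rule AE_le_const_if_nn_integral_le)
    show "g \<in> borel_measurable \<nu>"
      using cont by (simp add: measurable_eq_borel borel_measurable_continuous_onI)
    show "(\<integral>\<^sup>+ x. ennreal (max 0 (g x - 1)) \<partial>\<nu>) < \<infinity>"
      using integrable_continuous[OF cont_pos] by (subst nn_integral_eq_integral) auto
    show "(\<integral>\<^sup>+ x. ennreal (g x * max 0 (g x - 1)) \<partial>\<nu>) \<le> (\<integral>\<^sup>+ x. ennreal (1 * max 0 (g x - 1)) \<partial>\<nu>)"
      using nn_integral_sum_sigma_le[OF F cont_pos] by (simp add: g_def)
  qed simp
  then have "g x \<le> 1"
    by (rule closed_AE_imp_all[rotated]) (intro closed_Collect_le cont continuous_intros)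
  then show ?thesis by (simp add: g_def)
qed

definition moment :: "real \<Rightarrow> 'g pmf \<Rightarrow> 'x \<Rightarrow> ennreal" where
  "moment p \<eta> x = (\<integral>\<^sup>+ s. ennreal (\<sigma> s x powr p) \<partial>measure_pmf \<eta>)"

lemma moment_return_one: "moment p (return_pmf \<one>) x = 1"
  by (simp add: moment_def sigma_one)

lemma moment_convolution:
  assumes \<eta>: "set_pmf \<eta> \<subseteq> carrier G" and \<zeta>: "set_pmf \<zeta> \<subseteq> carrier G"
  shows "moment p (convolution G \<eta> \<zeta>) x =
    (\<integral>\<^sup>+ t. ennreal (\<sigma> t x powr p) * moment p \<eta> (act t x) \<partial>measure_pmf \<zeta>)"
  unfolding moment_def nn_integral_convolution
proof (intro nn_integral_cong_AE AE_pmfI)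
  fix t assume "t \<in> set_pmf \<zeta>"
  with \<zeta> have t: "t \<in> carrier G" by blast
  have "(\<integral>\<^sup>+ s. ennreal (\<sigma> (s \<otimes> t) x powr p) \<partial>measure_pmf \<eta>) =
      (\<integral>\<^sup>+ s. ennreal (\<sigma> t x powr p) * ennreal (\<sigma> s (act t x) powr p) \<partial>measure_pmf \<eta>)"
    using t \<eta> by (intro nn_integral_cong_AE)
      (auto simp: AE_measure_pmf_iff sigma_cocycle powr_mult sigma_nonneg ennreal_mult mult_ac)
  then show "(\<integral>\<^sup>+ s. ennreal (\<sigma> (s \<otimes> t) x powr p) \<partial>measure_pmf \<eta>) =
      ennreal (\<sigma> t x powr p) * (\<integral>\<^sup>+ s. ennreal (\<sigma> s (act t x) powr p) \<partial>measure_pmf \<eta>)"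
    by (simp add: nn_integral_cmult)
qed

lemma moment_convolution_le:
  assumes "set_pmf \<eta> \<subseteq> carrier G" "set_pmf \<zeta> \<subseteq> carrier G" and le_1: "\<And>y. moment p \<eta> y \<le> 1"
  shows "moment p (convolution G \<eta> \<zeta>) x \<le> moment p \<zeta> x"
proof -
  have "moment p (convolution G \<eta> \<zeta>) x \<le> (\<integral>\<^sup>+ t. ennreal (\<sigma> t x powr p) * 1 \<partial>measure_pmf \<zeta>)"
    unfolding moment_convolution[OF assms(1,2)] by (intro nn_integral_mono mult_left_mono le_1) simp
  then show ?thesis by (simp add: moment_def)
qed

lemma first_moment_le_1: "moment 1 \<mu> x \<le> 1"
proof -
  have "moment 1 \<mu> x = (\<integral>\<^sup>+ s. ennreal (\<sigma> s x) \<partial>measure_pmf \<mu>)"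
    unfolding moment_def using support_subset
    by (intro nn_integral_cong_AE) (auto simp: AE_measure_pmf_iff sigma_nonneg)
  also have "\<dots> \<le> 1"
    unfolding nn_integral_measure_pmf_SUP_finite
  proof (rule SUP_least)
    fix F assume "F \<in> {F. finite F \<and> F \<subseteq> set_pmf \<mu>}"
    then have F: "finite F" "F \<subseteq> carrier G" using support_subset by auto
    then have "(\<Sum>s\<in>F. ennreal (\<sigma> s x) * pmf \<mu> s) = ennreal (\<Sum>s\<in>F. \<sigma> s x * pmf \<mu> s)"
      by (subst sum_ennreal[symmetric]) (auto simp: sigma_nonneg ennreal_mult subset_iff)
    also have "\<dots> \<le> 1" using sum_sigma_le_1[OF F] by simp
    finally show "(\<Sum>s\<in>F. ennreal (\<sigma> s x) * pmf \<mu> s) \<le> 1" .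
  qed
  finally show ?thesis .
qed

lemma first_moment_convolution_power_le_1: "moment 1 (convolution_power G \<mu> n) x \<le> 1"
proof (induction n)
  case 0
  then show ?case by (simp add: moment_return_one)
next
  case (Suc n)
  have "moment 1 (convolution_power G \<mu> (Suc n)) x \<le> moment 1 (convolution_power G \<mu> n) x"
    using moment_convolution_le[OF support_subset set_pmf_convolution_power_subset]
    by (simp add: first_moment_le_1)
  with Suc show ?case by (rule order.trans[rotated])
qed

lemma moment_le_1_minus_square:
  assumes p: "0 \<le> p" "p \<le> 1" and \<eta>: "set_pmf \<eta> \<subseteq> carrier G" and le_1: "moment 1 \<eta> x \<le> 1"
  shows "moment p \<eta> x \<le> 1 - ennreal (p * (1 - p) * (sqrt (\<sigma> s x) - 1)\<^sup>2 * pmf \<eta> s)"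
proof -
  define gap where "gap t = p * (1 - p) * (sqrt (\<sigma> t x) - 1)\<^sup>2" for t
  have gap_nonneg: "0 \<le> gap t" for t using p by (simp add: gap_def)
  have "moment p \<eta> x + ennreal (gap s * pmf \<eta> s) \<le>
      moment p \<eta> x + (\<integral>\<^sup>+ t. ennreal (gap t) \<partial>measure_pmf \<eta>)"
    using sum_pmf_le_nn_integral[of "{s}" "\<lambda>t. ennreal (gap t)" \<eta>] gap_nonneg
    by (intro add_left_mono) (simp add: ennreal_mult)
  also have "\<dots> = (\<integral>\<^sup>+ t. ennreal (\<sigma> t x powr p) + ennreal (gap t) \<partial>measure_pmf \<eta>)"
    unfolding moment_def by (rule nn_integral_add[symmetric]) auto
  also have "\<dots> \<le> (\<integral>\<^sup>+ t. ennreal (1 - p) + ennreal p * ennreal (\<sigma> t x powr 1) \<partial>measure_pmf \<eta>)"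
  proof (intro nn_integral_mono_AE AE_pmfI)
    fix t assume "t \<in> set_pmf \<eta>"
    then have "0 \<le> \<sigma> t x" using \<eta> sigma_nonneg by blast
    then show "ennreal (\<sigma> t x powr p) + ennreal (gap t)
        \<le> ennreal (1 - p) + ennreal p * ennreal (\<sigma> t x powr 1)"
      using powr_le_tangent_minus_square[of "\<sigma> t x" p] p gap_nonneg[of t]
      by (simp add: gap_def flip: ennreal_mult ennreal_plus)
  qed
  also have "\<dots> = ennreal (1 - p) + ennreal p * moment 1 \<eta> x"
    by (simp add: moment_def nn_integral_add nn_integral_cmult)
  also have "\<dots> \<le> ennreal (1 - p) + ennreal p * 1"
    by (intro add_left_mono mult_left_mono le_1) simp
  also have "\<dots> = 1" using p by (simp flip: ennreal_plus)
  finally show ?thesis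
    by (simp add: gap_def ennreal_le_minus_iff add.commute)
qed

lemma moment_le_1:
  assumes "0 \<le> p" "p \<le> 1" "set_pmf \<eta> \<subseteq> carrier G" "moment 1 \<eta> x \<le> 1"
  shows "moment p \<eta> x \<le> 1"
  using moment_le_1_minus_square[OF assms]
  by (rule order.trans) (rule diff_le_self_ennreal)

lemma decseq_moment_convolution_power:
  assumes "0 \<le> p" "p \<le> 1"
  shows "decseq (\<lambda>n. moment p (convolution_power G \<mu> n) x)"
  using moment_convolution_le[OF support_subset set_pmf_convolution_power_subset]
  by (intro decseq_SucI) (simp add: moment_le_1 first_moment_le_1 support_subset assms)

lemma moment_locally_less_1:
  assumes p: "0 < p" "p < 1" and s: "s \<in> carrier G" "\<sigma> s x \<noteq> 1"
  shows "\<exists>n c. c < 1 \<and> (\<forall>\<^sub>F y in nhds x. moment p (convolution_power G \<mu> n) y \<le> c)"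
proof -
  obtain n where n: "s \<in> set_pmf (convolution_power G \<mu> n)"
    using s carrier_eq_UN_set_pmf_convolution_power by auto
  define \<eta> where "\<eta> = convolution_power G \<mu> n"
  have \<eta>: "set_pmf \<eta> \<subseteq> carrier G" "moment 1 \<eta> y \<le> 1" for y
    unfolding \<eta>_def
    by (rule set_pmf_convolution_power_subset first_moment_convolution_power_le_1)+
  define gap where "gap y = p * (1 - p) * (sqrt (\<sigma> s y) - 1)\<^sup>2 * pmf \<eta> s" for y
  have gap_pos: "0 < gap x" using p s n by (simp add: gap_def \<eta>_def pmf_positive)
  have "continuous_on UNIV gap"
    unfolding gap_def by (intro continuous_intros continuous_sigma s)
  then have "(gap \<longlongrightarrow> gap x) (nhds x)"
    by (simp add: continuous_on_def tendsto_at_iff_tendsto_nhds)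
  then have "\<forall>\<^sub>F y in nhds x. gap x / 2 < gap y"
    by (rule order_tendstoD) (use gap_pos in simp)
  then have "\<forall>\<^sub>F y in nhds x. moment p \<eta> y \<le> 1 - ennreal (gap x / 2)"
  proof eventually_elim
    case (elim y)
    have "moment p \<eta> y \<le> 1 - ennreal (gap y)"
      unfolding gap_def using p by (intro moment_le_1_minus_square \<eta>) auto
    also have "\<dots> \<le> 1 - ennreal (gap x / 2)"
      using elim by (intro ennreal_minus_mono ennreal_leI) auto
    finally show ?case .
  qed
  moreover have "1 - ennreal (gap x / 2) < 1"
    using gap_pos by (intro ennreal_between) auto
  ultimately show ?thesis unfolding \<eta>_def by blast
qed

end

theorem proposition4p3:
  fixes G :: "('g, 'b) monoid_scheme" and \<mu> :: "'g pmf"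
    and act :: "'g \<Rightarrow> 'x::topological_space \<Rightarrow> 'x" and \<nu> :: "'x measure"
    and \<sigma> :: "'g \<Rightarrow> 'x \<Rightarrow> real" and \<epsilon> :: real
  assumes "measured_group G \<mu>"
    and "compact_stationary_space G \<mu> act \<nu>"
    and "minimal_action G act"
    and "\<And>s. s \<in> carrier G \<Longrightarrow> continuous_representative \<nu> (RN_cocycle G act \<nu> s) (\<sigma> s)"
    and "\<not> invariant_measure G act \<nu>"
    and "0 < \<epsilon>" and "\<epsilon> < 1/2"
  shows "\<exists>n::nat. (SUP x. \<integral>\<^sup>+ s. ennreal (\<sigma> s x powr (1 - 2 * \<epsilon>))
    \<partial>measure_pmf (convolution_power G \<mu> n)) < 1"
proof -
  interpret compact_stationary_space G \<mu> act \<nu> by fact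
  interpret continuous_cocycle_space G \<mu> act \<nu> \<sigma>
    by unfold_locales (use assms in auto)
  have p: "0 < 1 - 2 * \<epsilon>" "1 - 2 * \<epsilon> < 1" using \<open>0 < \<epsilon>\<close> \<open>\<epsilon> < 1/2\<close> by auto
  have "\<exists>n. (SUP x. moment (1 - 2 * \<epsilon>) (convolution_power G \<mu> n) x) < 1"
  proof (rule compact_decseq_SUP_less[OF compact])
    show "decseq (\<lambda>n. moment (1 - 2 * \<epsilon>) (convolution_power G \<mu> n) x)" for x
      using p by (intro decseq_moment_convolution_power) auto
    fix x
    obtain s where "s \<in> carrier G" "\<sigma> s x \<noteq> 1"
      using invariant_if_sigma_eq_1 \<open>\<not> invariant_measure G act \<nu>\<close> by blast
    then show "\<exists>n c. c < 1 \<and>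
        (\<forall>\<^sub>F y in nhds x. moment (1 - 2 * \<epsilon>) (convolution_power G \<mu> n) y \<le> c)"
      by (rule moment_locally_less_1[OF p])
  qed (simp add: bot_ennreal)
  then show ?thesis by (simp add: moment_def)
qed

end
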